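(* Let $G$ be an equidistant grid on $Q$ and let $f:Q\to\mathbb{R}$ and $w:Q\to(0,\infty)$ be $G$-constant functions. Then $p_\sigma^w(f)$ is $G$-constant and $$p_\sigma^w(f)=\sum_{x\in G} p_\sigma^{w|_G}(f|_G)(x)\,\chi_{C^G(x)}.$$ More precisely, the function on the right-hand side is a $\sigma$-monotonic representative of $p_\sigma^w(f)$.
   Context: Let $Q=[a_1,b_1]\times\dots\times[a_d,b_d]\subset\mathbb{R}^d$ with $a_i<b_i$, and $\sigma\in\{-1,0,1\}^d$. For $x,y\in\mathbb{R}^d$ write $x\le_\sigma y$ iff $\sigma_ix_i\le\sigma_iy_i$ for all $i$ with $\sigma_i=\pm1$ and $x_i=y_i$ for all $i$ with $\sigma_i=0$. For $X\subset\mathbb{R}^d$, a function $f:X\to\mathbb{R}$ is $\sigma$-monotonic iff $x\le_\sigma y$ implies $f(x)\le f(y)$ for all $x,y\in X$. $L^2_\sigma(Q,\mathbb{R})$ is the set of $f\in L^2(Q,\mathbb{R})$ (Lebesgue measure) such that some (equivalently every) representative $f_0$ of $f$ is $\sigma$-monotonic on $Q\setminus N$ for some null set $N$. For a measurable $w:Q\to\mathbb{R}$ bounded above and below by positive constants and $f\in L^2(Q,\mathbb{R})$, $p_\sigma^w(f)$ denotes the unique minimizer of $g\mapsto\int_Q|f(x)-g(x)|^2w(x)\,dx$ over $g\in L^2_\sigma(Q,\mathbb{R})$. For a finite non-empty $G\subset\mathbb{R}^d$, $f_G:G\to\mathbb{R}$ and $w_G:G\to(0,\infty)$, $p_\sigma^{w_G}(f_G)$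 denotes the unique minimizer of $g\mapsto\sum_{x\in G}|f_G(x)-g(x)|^2w_G(x)$ over all $\sigma$-monotonic $g:G\to\mathbb{R}$. Grids: given partitions $a_i=t_{i0}<t_{i1}<\dots<t_{im_i}=b_i$ of $[a_i,b_i]$ for $i=1,\dots,d$, the associated grid on $Q$ is $G=G_1\times\dots\times G_d$ with $G_i=\{(t_{i,k-1}+t_{ik})/2:k=1,\dots,m_i\}$. It is equidistant iff $t_{ik}-t_{i,k-1}=(b_i-a_i)/m_i$ for all $i,k$. A cell of $G$ is a set $I_1\times\dots\times I_d$ where each $I_i$ is either $[t_{i,k-1},t_{ik})$ for some $k\in\{1,\dots,m_i-1\}$ or $[t_{i,m_i-1},t_{im_i}]$. $Q$ is the disjoint union of the cells of $G$, and $C^G(x)$ denotes the cell containing $x\in Q$. A function on $Q$ is $G$-constant iff it is constant on each cell of $G$; an equivalence class is $G$-constant iff it has a $G$-constant representative. $\chi_E$ is the characteristic function of $E$. *)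

theory Defs
  imports "HOL-Analysis.Analysis"
begin

definition sigma_le :: "int ^ 'n \<Rightarrow> real ^ 'n \<Rightarrow> real ^ 'n \<Rightarrow> bool" where
  "sigma_le \<sigma> x y \<longleftrightarrow>
     (\<forall>i. (\<sigma> $ i \<in> {-1, 1} \<longrightarrow> of_int (\<sigma> $ i) * x $ i \<le> of_int (\<sigma> $ i) * y $ i) \<and>
          (\<sigma> $ i = 0 \<longrightarrow> x $ i = y $ i))"

definition sigma_monotonic :: "int ^ 'n \<Rightarrow> (real ^ 'n) set \<Rightarrow> (real ^ 'n \<Rightarrow> real) \<Rightarrow> bool" where
  "sigma_monotonic \<sigma> X f \<longleftrightarrow> (\<forall>x\<in>X. \<forall>y\<in>X. sigma_le \<sigma> x y \<longrightarrow> f x \<le> f y)"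


text \<open>Functions on \<open>Q\<close> are total functions whose values outside \<open>Q\<close> are irrelevant: measurability,
  integrability and almost-everywhere equality refer to Lebesgue measure on \<open>Q\<close>. Elements of
  \<open>L2 Q\<close> are genuine equivalence classes, i.e. sets of functions.\<close>

definition L2_fun :: "(real ^ 'n) set \<Rightarrow> (real ^ 'n \<Rightarrow> real) set" where
  "L2_fun Q = {f. f \<in> borel_measurable (lebesgue_on Q) \<and> integrable (lebesgue_on Q) (\<lambda>x. (f x)\<^sup>2)}"

definition L2_rel :: "(real ^ 'n) set \<Rightarrow> ((real ^ 'n \<Rightarrow> real) \<times> (real ^ 'n \<Rightarrow> real)) set" where
  "L2_rel Q = {(f, g). f \<in> L2_fun Q \<and> g \<in> L2_fun Q \<and> (AE x in lebesgue_on Q. f x = g x)}"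

definition L2 :: "(real ^ 'n) set \<Rightarrow> (real ^ 'n \<Rightarrow> real) set set" where
  "L2 Q = L2_fun Q // L2_rel Q"

definition L2_class :: "(real ^ 'n) set \<Rightarrow> (real ^ 'n \<Rightarrow> real) \<Rightarrow> (real ^ 'n \<Rightarrow> real) set" where
  "L2_class Q f = L2_rel Q `` {f}"

definition L2_sigma :: "int ^ 'n \<Rightarrow> (real ^ 'n) set \<Rightarrow> (real ^ 'n \<Rightarrow> real) set set" where
  "L2_sigma \<sigma> Q =
     {F \<in> L2 Q. \<exists>f0\<in>F. \<exists>N\<in>null_sets lebesgue. sigma_monotonic \<sigma> (Q - N) f0}"

text \<open>The integral does not depend on the choice of representatives, so the image below is a
  singleton for \<open>F, H \<in> L2 Q\<close>.\<close>

definition weighted_error ::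
    "(real ^ 'n) set \<Rightarrow> (real ^ 'n \<Rightarrow> real) \<Rightarrow> (real ^ 'n \<Rightarrow> real) set \<Rightarrow> (real ^ 'n \<Rightarrow> real) set \<Rightarrow> real" where
  "weighted_error Q w F H =
     the_elem ((\<lambda>(f, h). LINT x|lebesgue_on Q. \<bar>f x - h x\<bar>\<^sup>2 * w x) ` (F \<times> H))"

definition proj_L2 ::
    "int ^ 'n \<Rightarrow> (real ^ 'n) set \<Rightarrow> (real ^ 'n \<Rightarrow> real) \<Rightarrow> (real ^ 'n \<Rightarrow> real) set \<Rightarrow> (real ^ 'n \<Rightarrow> real) set" where
  "proj_L2 \<sigma> Q w F = (THE H. is_arg_min (weighted_error Q w F) (\<lambda>H. H \<in> L2_sigma \<sigma> Q) H)"


text \<open>Functions on a finite set \<open>G\<close> are taken to be extensional (\<open>undefined\<close> outside \<open>G\<close>), since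
  otherwise the minimizer would not be unique as a total function.\<close>

definition proj_finite ::
    "int ^ 'n \<Rightarrow> (real ^ 'n) set \<Rightarrow> (real ^ 'n \<Rightarrow> real) \<Rightarrow> (real ^ 'n \<Rightarrow> real) \<Rightarrow> (real ^ 'n \<Rightarrow> real)" where
  "proj_finite \<sigma> G w f =
     (THE g. is_arg_min (\<lambda>g. \<Sum>x\<in>G. \<bar>f x - g x\<bar>\<^sup>2 * w x)
               (\<lambda>g. g \<in> G \<rightarrow>\<^sub>E UNIV \<and> sigma_monotonic \<sigma> G g) g)"


text \<open>A grid on \<open>cbox a b\<close> is given by its partition points \<open>t i 0 < \<dots> < t i (m i)\<close> in each
  coordinate \<open>i\<close>; the midpoints together with \<open>a\<close> determine them, and the cells are defined from them.\<close>

definition grid_partition ::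
    "real ^ 'n \<Rightarrow> real ^ 'n \<Rightarrow> ('n \<Rightarrow> nat) \<Rightarrow> ('n \<Rightarrow> nat \<Rightarrow> real) \<Rightarrow> bool" where
  "grid_partition a b m t \<longleftrightarrow>
     (\<forall>i. t i 0 = a $ i \<and> t i (m i) = b $ i \<and> (\<forall>k\<in>{1..m i}. t i (k - 1) < t i k))"

definition equidistant ::
    "real ^ 'n \<Rightarrow> real ^ 'n \<Rightarrow> ('n \<Rightarrow> nat) \<Rightarrow> ('n \<Rightarrow> nat \<Rightarrow> real) \<Rightarrow> bool" where
  "equidistant a b m t \<longleftrightarrow>
     (\<forall>i. \<forall>k\<in>{1..m i}. t i k - t i (k - 1) = (b $ i - a $ i) / real (m i))"

definition grid_points :: "('n \<Rightarrow> nat) \<Rightarrow> ('n \<Rightarrow> nat \<Rightarrow> real) \<Rightarrow> (real ^ 'n) set" where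
  "grid_points m t = {x. \<forall>i. \<exists>k\<in>{1..m i}. x $ i = (t i (k - 1) + t i k) / 2}"

definition cell_interval :: "('n \<Rightarrow> nat) \<Rightarrow> ('n \<Rightarrow> nat \<Rightarrow> real) \<Rightarrow> 'n \<Rightarrow> nat \<Rightarrow> real set" where
  "cell_interval m t i k = (if k < m i then {t i (k - 1)..<t i k} else {t i (k - 1)..t i k})"

definition grid_cells :: "('n \<Rightarrow> nat) \<Rightarrow> ('n \<Rightarrow> nat \<Rightarrow> real) \<Rightarrow> (real ^ 'n) set set" where
  "grid_cells m t =
     {{x. \<forall>i. x $ i \<in> cell_interval m t i (\<kappa> i)} | \<kappa>. \<forall>i. \<kappa> i \<in> {1..m i}}"

definition cell_of :: "('n \<Rightarrow> nat) \<Rightarrow> ('n \<Rightarrow> nat \<Rightarrow> real) \<Rightarrow> real ^ 'n \<Rightarrow> (real ^ 'n) set" where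
  "cell_of m t x = (THE C. C \<in> grid_cells m t \<and> x \<in> C)"

definition grid_constant ::
    "('n \<Rightarrow> nat) \<Rightarrow> ('n \<Rightarrow> nat \<Rightarrow> real) \<Rightarrow> (real ^ 'n \<Rightarrow> real) \<Rightarrow> bool" where
  "grid_constant m t f \<longleftrightarrow> (\<forall>C\<in>grid_cells m t. f constant_on C)"

definition grid_constant_class ::
    "('n \<Rightarrow> nat) \<Rightarrow> ('n \<Rightarrow> nat \<Rightarrow> real) \<Rightarrow> (real ^ 'n \<Rightarrow> real) set \<Rightarrow> bool" where
  "grid_constant_class m t F \<longleftrightarrow> (\<exists>f0\<in>F. grid_constant m t f0)"

end

theory Submission
  imports Defs
begin

text \<open>
  Averaging a function over the cells is the orthogonal projection of the weighted \<open>L\<^sup>2\<close> space onto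
  the grid-constant functions, because the weight is constant on each cell. As all cells are
  translates of each other up to a null set, this averaging preserves \<open>\<sigma>\<close>-monotonicity. Hence, by
  Pythagoras, the error of a \<open>\<sigma>\<close>-monotonic \<open>g\<close> is the cell volume times the finite error of the cell
  averages plus the weighted variance of \<open>g\<close> on the cells. The first summand is least exactly for the
  finite projection, the second vanishes exactly for grid-constant \<open>g\<close>; this yields the minimizer and
  its uniqueness without any completeness argument.
\<close>

section \<open>Existence and uniqueness of the finite projection\<close>

text \<open>Existence comes from compactness: only functions with error at most that of the zero
  function compete. Uniqueness comes from strict convexity of the error. Both are needed to resolve
  the definite description in \<open>proj_finite\<close>.\<close>

lemma proj_finite_is_arg_min:
  fixes \<sigma> :: "int ^ 'n" and w f :: "real ^ 'n \<Rightarrow> real"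
  assumes fin: "finite G" and w: "\<And>x. x \<in> G \<Longrightarrow> 0 < w x"
  defines "E \<equiv> \<lambda>g. \<Sum>x\<in>G. \<bar>f x - g x\<bar>\<^sup>2 * w x"
    and "M \<equiv> \<lambda>g. g \<in> G \<rightarrow>\<^sub>E UNIV \<and> sigma_monotonic \<sigma> G g"
  shows "is_arg_min E M (proj_finite \<sigma> G w f)"
    and "is_arg_min E M g \<Longrightarrow> g = proj_finite \<sigma> G w f"
proof -
  define z :: "real ^ 'n \<Rightarrow> real" where "z = restrict (\<lambda>x. 0) G"
  have Mz: "M z" by (auto simp: M_def z_def sigma_monotonic_def)
  \<comment> \<open>If the error of \<open>g\<close> is at most \<open>E z\<close>, so is each of
    its summands; solving this for \<open>g x\<close> gives the bound \<open>B x\<close>.\<close>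
  define B where "B x = \<bar>f x\<bar> + sqrt (E z / w x)" for x
  \<comment> \<open>Off \<open>G\<close> the factor is the singleton of \<open>undefined\<close>, so
    \<open>T\<close> consists of extensional functions and is still a product of compact
    sets.\<close>
  define T where "T = Pi\<^sub>E UNIV (\<lambda>x. if x \<in> G then {- B x..B x} else {undefined})"
  have bound: "g \<in> T" if g: "g \<in> G \<rightarrow>\<^sub>E UNIV" and le: "E g \<le> E z" for g
  proof -
    have "\<bar>g x\<bar> \<le> B x" if x: "x \<in> G" for x
    proof -
      have "\<bar>f x - g x\<bar>\<^sup>2 * w x \<le> E g"
        unfolding E_def using fin w by (intro member_le_sum[OF x]) (auto intro!: mult_nonneg_nonneg less_imp_le[OF w])
      then have "\<bar>f x - g x\<bar>\<^sup>2 * w x \<le> E z" using le by linarith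
      then have "\<bar>f x - g x\<bar>\<^sup>2 \<le> E z / w x" using w[OF x] by (simp add: field_simps)
      then have "\<bar>f x - g x\<bar> \<le> sqrt (E z / w x)" by (simp add: real_le_rsqrt)
      then show ?thesis unfolding B_def by linarith
    qed
    then show ?thesis using g by (force simp: T_def PiE_def extensional_def abs_le_iff)
  qed
  have "compactin (product_topology (\<lambda>_. euclidean) UNIV) T"
    unfolding T_def compactin_PiE by auto
  then have "compact T" by (simp add: euclidean_product_topology)
  \<comment> \<open>Monotonicity is an intersection of conditions \<open>g x \<le> g y\<close>, each
    closed because evaluation at a point is continuous in the product topology.\<close>
  moreover have "closed {g :: real ^ 'n \<Rightarrow> real. sigma_monotonic \<sigma> G g}"
  proof -
    have *: "{g :: real ^ 'n \<Rightarrow> real. sigma_monotonic \<sigma> G g} =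
        (\<Inter>x\<in>G. \<Inter>y\<in>{y \<in> G. sigma_le \<sigma> x y}. {g. g x \<le> g y})"
      by (auto simp: sigma_monotonic_def)
    show ?thesis unfolding *
      by (intro closed_INT ballI closed_Collect_le continuous_on_product_coordinates)
  qed
  ultimately have "compact (T \<inter> {g. sigma_monotonic \<sigma> G g})"
    by (rule compact_Int_closed)
  moreover have "z \<in> T \<inter> {g. sigma_monotonic \<sigma> G g}"
    using bound[of z] Mz by (auto simp: M_def)
  moreover have "continuous_on (T \<inter> {g. sigma_monotonic \<sigma> G g}) E"
    unfolding E_def
    by (intro continuous_intros continuous_on_subset[OF continuous_on_product_coordinates]) auto
  ultimately obtain g0 where g0: "g0 \<in> T" "sigma_monotonic \<sigma> G g0"
    and min: "\<And>g. g \<in> T \<Longrightarrow> sigma_monotonic \<sigma> G g \<Longrightarrow> E g0 \<le> E g"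
    using continuous_attains_inf[of "T \<inter> {g. sigma_monotonic \<sigma> G g}" E] by blast
  have "M g0"
    using g0 by (auto simp: M_def T_def PiE_def extensional_def Pi_def split: if_splits)
  \<comment> \<open>An admissible function outside \<open>T\<close> has error above
    \<open>E z\<close>, and \<open>z\<close> itself lies in \<open>T\<close>.\<close>
  moreover have "E g0 \<le> E g" if "M g" for g
    using min[of g] min[of z] bound[of g] bound[of z] Mz that by (force simp: M_def)
  ultimately have g0_min: "is_arg_min E M g0"
    by (auto simp: is_arg_min_linorder)
  have uniq: "g = h" if "is_arg_min E M g" "is_arg_min E M h" for g h
  proof -
    have M: "M g" "M h" and eq: "E g = E h" and le: "\<And>k. M k \<Longrightarrow> E g \<le> E k"
      using that by (auto simp: is_arg_min_linorder intro: antisym)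
    \<comment> \<open>The average of two minimizers is admissible again; \<open>restrict\<close>
      keeps it extensional. If they differed, it would have strictly smaller error.\<close>
    define k where "k = restrict (\<lambda>x. (g x + h x) / 2) G"
    have "M k" using M unfolding M_def k_def sigma_monotonic_def
      by (auto intro!: divide_right_mono add_mono)
    \<comment> \<open>parallelogram identity\<close>
    have "E g + E h = 2 * E k + (\<Sum>x\<in>G. (g x - h x)\<^sup>2 * w x) / 2"
      unfolding E_def k_def sum_distrib_left sum_divide_distrib sum.distrib[symmetric]
      by (intro sum.cong) (auto simp: power2_eq_square field_simps)
    then have "(\<Sum>x\<in>G. (g x - h x)\<^sup>2 * w x) \<le> 0"
      using eq le[OF \<open>M k\<close>] by linarith
    then have "(\<Sum>x\<in>G. (g x - h x)\<^sup>2 * w x) = 0"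
      using w by (intro antisym sum_nonneg) (auto intro!: mult_nonneg_nonneg less_imp_le[OF w])
    then have "\<forall>x\<in>G. (g x - h x)\<^sup>2 * w x = 0"
      using w fin by (subst (asm) sum_nonneg_eq_0_iff) (auto intro!: mult_nonneg_nonneg less_imp_le[OF w])
    then have "\<forall>x\<in>G. g x = h x" using w by fastforce
    then show ?thesis using M unfolding M_def by (intro PiE_ext[of g G "\<lambda>_. UNIV" h]) auto
  qed
  have g0_eq: "proj_finite \<sigma> G w f = g0"
    unfolding proj_finite_def E_def[symmetric] M_def[symmetric]
  proof (rule the_equality[where P = "is_arg_min E M"])
    show "g = g0" if "is_arg_min E M g" for g using uniq[of g g0] that g0_min by blast
  qed (rule g0_min)
  show "is_arg_min E M (proj_finite \<sigma> G w f)" unfolding g0_eq by (rule g0_min)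
  show "g = proj_finite \<sigma> G w f" if "is_arg_min E M g"
    unfolding g0_eq using that g0_min by (rule uniq)
qed

section \<open>Integrals over partitions, mean values and translations\<close>

lemma integrable_lebesgue_on_partition:
  fixes F :: "'a::euclidean_space \<Rightarrow> real"
  assumes "finite K" "disjoint_family_on A K" "\<And>k. k \<in> K \<Longrightarrow> A k \<in> sets lebesgue"
    and F: "integrable (lebesgue_on (\<Union>k\<in>K. A k)) F"
  shows "k \<in> K \<Longrightarrow> integrable (lebesgue_on (A k)) F"
    and "(LINT x|lebesgue_on (\<Union>k\<in>K. A k). F x) = (\<Sum>k\<in>K. LINT x|lebesgue_on (A k). F x)"
proof -
  have U: "(\<Union>k\<in>K. A k) \<in> sets lebesgue" using assms by auto
  then have "set_integrable lebesgue (\<Union>k\<in>K. A k) F"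
    using F by (simp add: integrable_restrict_space set_integrable_def)
  then have s: "set_integrable lebesgue (A k) F" if "k \<in> K" for k
    using assms(3) that by (elim set_integrable_subset) auto
  then show "integrable (lebesgue_on (A k)) F" if "k \<in> K"
    using assms(3) that by (simp add: integrable_restrict_space set_integrable_def)
  have "(LINT x:(\<Union>k\<in>K. A k)|lebesgue. F x) = (\<Sum>k\<in>K. LINT x:A k|lebesgue. F x)"
    using assms s by (intro set_integral_finite_Union) auto
  then show "(LINT x|lebesgue_on (\<Union>k\<in>K. A k). F x) = (\<Sum>k\<in>K. LINT x|lebesgue_on (A k). F x)"
    using U assms(3) by (simp add: integral_restrict_space set_lebesgue_integral_def)
qed

text \<open>On a finite measure space \<open>1 + (g x)\<^sup>2\<close> is an integrable majorant of
  \<open>\<bar>g x\<bar>\<close>. This is what makes cell averages of square-integrable functions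
  available.\<close>

lemma integrable_square_imp_integrable:
  fixes g :: "'a \<Rightarrow> real"
  assumes "finite_measure N" "g \<in> borel_measurable N" "integrable N (\<lambda>x. (g x)\<^sup>2)"
  shows "integrable N g"
proof (rule Bochner_Integration.integrable_bound)
  show "integrable N (\<lambda>x. 1 + (g x)\<^sup>2)"
    using assms finite_measure.integrable_const by (intro Bochner_Integration.integrable_add) auto
  have "\<bar>g x\<bar> \<le> 1 + (g x)\<^sup>2" for x
    using zero_le_power2[of "\<bar>g x\<bar> - 1"] by (simp add: power2_eq_square algebra_simps)
  then show "AE x in N. norm (g x) \<le> norm (1 + (g x)\<^sup>2)" 
    by (auto intro!: AE_I2 order_trans[OF _ abs_ge_self])
qed (use assms in auto)

text \<open>The cross term vanishes when \<open>h\<close> is the mean of \<open>g\<close>: this is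
  the decomposition into squared bias and variance. The mean is characterized by a product rather
  than a quotient, so measure zero needs no separate case.\<close>

lemma integral_square_diff_const:
  fixes g :: "'a \<Rightarrow> real"
  assumes "finite_measure N" "g \<in> borel_measurable N" "integrable N (\<lambda>x. (g x)\<^sup>2)"
  shows "integrable N (\<lambda>x. (c - g x)\<^sup>2)"
    and "measure N (space N) * h = (LINT x|N. g x) \<Longrightarrow> (LINT x|N. (c - g x)\<^sup>2) =
      measure N (space N) * (c - h)\<^sup>2 + (LINT x|N. (h - g x)\<^sup>2)"
proof -
  interpret finite_measure N by fact
  have g: "integrable N g" by (rule integrable_square_imp_integrable[OF assms])
  have eq: "(\<lambda>x. (c - g x)\<^sup>2) = (\<lambda>x. c\<^sup>2 - 2 * c * g x + (g x)\<^sup>2)" for c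
    by (auto simp: power2_diff)
  show "integrable N (\<lambda>x. (c - g x)\<^sup>2)" unfolding eq using g assms by auto
  have E: "(LINT x|N. (c - g x)\<^sup>2) =
     measure N (space N) * c\<^sup>2 - 2 * c * (LINT x|N. g x) + (LINT x|N. (g x)\<^sup>2)" for c
    unfolding eq using g assms by simp
  show "(LINT x|N. (c - g x)\<^sup>2) =
      measure N (space N) * (c - h)\<^sup>2 + (LINT x|N. (h - g x)\<^sup>2)"
    if "measure N (space N) * h = (LINT x|N. g x)"
    unfolding E[of c] E[of h] that[symmetric] by (simp add: power2_eq_square algebra_simps)
qed

lemma integral_cbox_translate_le:
  fixes g :: "'a::euclidean_space \<Rightarrow> real"
  assumes g: "g integrable_on cbox l u" "g integrable_on cbox (l + v) (u + v)"
    and N: "negligible N"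
    and le: "\<And>x. x \<in> cbox l u \<Longrightarrow> x \<notin> N \<Longrightarrow> x + v \<notin> N \<Longrightarrow> g x \<le> g (x + v)"
  shows "integral (cbox l u) g \<le> integral (cbox (l + v) (u + v)) g"
proof -
  \<comment> \<open>The comparison may fail where \<open>x\<close> or its translate is exceptional.
    Both functions are set to 0 on this negligible set, so that the inequality holds everywhere on
    the box.\<close>
  define N' where "N' = N \<union> {x. x + v \<in> N}"
  have "{x. x + v \<in> N} = (+) (- v) ` N" by (force simp: image_iff algebra_simps)
  then have N': "negligible N'"
    using N negligible_translation[OF N, of "- v"] by (auto simp: N'_def)
  have g': "(\<lambda>x. g (x + v)) integrable_on cbox l u"
    using integrable_shift_cbox[OF g(2), of v] by simp
  have "integral (cbox l u) g = integral (cbox l u) (\<lambda>x. if x \<in> N' then 0 else g x)"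
    by (rule integral_spike[OF N']) auto
  also have "\<dots> \<le> integral (cbox l u) (\<lambda>x. if x \<in> N' then 0 else g (x + v))"
  proof (rule integral_le)
    show "(\<lambda>x. if x \<in> N' then 0 else g x) integrable_on cbox l u"
      by (rule integrable_spike[OF g(1) N']) auto
    show "(\<lambda>x. if x \<in> N' then 0 else g (x + v)) integrable_on cbox l u"
      by (rule integrable_spike[OF g' N']) auto
  qed (use le in \<open>auto simp: N'_def\<close>)
  also have "\<dots> = integral (cbox l u) (\<lambda>x. g (x + v))"
    by (rule integral_spike[OF N']) auto
  also have "\<dots> = integral (cbox (l + v) (u + v)) g"
    using integral_shift_cbox[of "l + v" v "u + v" g] by simp
  finally show ?thesis .
qed

text \<open>On each piece the weight is the constant \<open>d k\<close>, so the plain mean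
  \<open>h k\<close> is also the weighted mean and the bias-variance decomposition applies there.
  Summing gives the error of the means plus the weighted variances.\<close>

lemma L2_error_partition:
  fixes A :: "'k \<Rightarrow> (real ^ 'n) set"
  assumes K: "finite K" "disjoint_family_on A K" "\<And>k. k \<in> K \<Longrightarrow> A k \<in> lmeasurable"
    and g: "g \<in> L2_fun (\<Union>k\<in>K. A k)"
    and f: "\<And>k x. k \<in> K \<Longrightarrow> x \<in> A k \<Longrightarrow> f x = c k"
    and w: "\<And>k x. k \<in> K \<Longrightarrow> x \<in> A k \<Longrightarrow> w x = (d k :: real)"
    and h: "\<And>k. k \<in> K \<Longrightarrow> measure lebesgue (A k) * h k = (LINT x|lebesgue_on (A k). g x)"
  shows "(LINT x|lebesgue_on (\<Union>k\<in>K. A k). \<bar>f x - g x\<bar>\<^sup>2 * w x) =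
      (\<Sum>k\<in>K. measure lebesgue (A k) * ((c k - h k)\<^sup>2 * d k)) +
      (\<Sum>k\<in>K. (LINT x|lebesgue_on (A k). (h k - g x)\<^sup>2) * d k)"
proof -
  let ?Q = "\<Union>k\<in>K. A k"
  have sets: "A k \<in> sets lebesgue" if "k \<in> K" for k using K(3)[OF that] by auto
  have gk: "finite_measure (lebesgue_on (A k))" "g \<in> borel_measurable (lebesgue_on (A k))"
    "integrable (lebesgue_on (A k)) (\<lambda>x. (g x)\<^sup>2)" if k: "k \<in> K" for k
  proof -
    show "finite_measure (lebesgue_on (A k))" using K(3)[OF k] by (rule finite_measure_lebesgue_on)
    show "g \<in> borel_measurable (lebesgue_on (A k))"
      using g k by (auto simp: L2_fun_def intro: measurable_restrict_mono)
    show "integrable (lebesgue_on (A k)) (\<lambda>x. (g x)\<^sup>2)"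
      using g integrable_lebesgue_on_partition(1)[OF K(1,2) sets _ k] by (auto simp: L2_fun_def)
  qed
  have ik: "integrable (lebesgue_on (A k)) (\<lambda>x. \<bar>f x - g x\<bar>\<^sup>2 * w x)"
    and eqk: "(LINT x|lebesgue_on (A k). \<bar>f x - g x\<bar>\<^sup>2 * w x) =
      (LINT x|lebesgue_on (A k). (c k - g x)\<^sup>2) * d k" if k: "k \<in> K" for k
  proof -
    have eq: "\<bar>f x - g x\<bar>\<^sup>2 * w x = (c k - g x)\<^sup>2 * d k" if "x \<in> space (lebesgue_on (A k))" for x
      using f[of k x] w[of k x] k that by (auto simp: space_restrict_space)
    have "integrable (lebesgue_on (A k)) (\<lambda>x. (c k - g x)\<^sup>2 * d k)"
      using integral_square_diff_const(1)[OF gk[OF k]] by simp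
    then show "integrable (lebesgue_on (A k)) (\<lambda>x. \<bar>f x - g x\<bar>\<^sup>2 * w x)"
      by (subst Bochner_Integration.integrable_cong[OF refl eq])
    show "(LINT x|lebesgue_on (A k). \<bar>f x - g x\<bar>\<^sup>2 * w x) =
      (LINT x|lebesgue_on (A k). (c k - g x)\<^sup>2) * d k"
      by (subst Bochner_Integration.integral_cong[OF refl eq]) auto
  qed
  \<comment> \<open>Only the square of \<open>g\<close> is known to be integrable on the union;
    integrability of the weighted error is assembled from the pieces before its integral is
    split.\<close>
  have "set_integrable lebesgue ?Q (\<lambda>x. \<bar>f x - g x\<bar>\<^sup>2 * w x)"
    using K sets ik 
    by (intro set_integrable_UN) (auto simp: set_integrable_def integrable_restrict_space)
  then have "integrable (lebesgue_on ?Q) (\<lambda>x. \<bar>f x - g x\<bar>\<^sup>2 * w x)"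
    using K(1) sets by (subst integrable_restrict_space) (auto simp: set_integrable_def)
  then have "(LINT x|lebesgue_on ?Q. \<bar>f x - g x\<bar>\<^sup>2 * w x) =
      (\<Sum>k\<in>K. LINT x|lebesgue_on (A k). \<bar>f x - g x\<bar>\<^sup>2 * w x)"
    using sets by (intro integrable_lebesgue_on_partition(2)[OF K(1,2)])
  also have "\<dots> = (\<Sum>k\<in>K. measure lebesgue (A k) * ((c k - h k)\<^sup>2 * d k) +
      (LINT x|lebesgue_on (A k). (h k - g x)\<^sup>2) * d k)"
  proof (intro sum.cong refl)
    fix k assume k: "k \<in> K"
    have m: "measure (lebesgue_on (A k)) (space (lebesgue_on (A k))) = measure lebesgue (A k)"
      using sets[OF k] by (simp add: measure_restrict_space space_restrict_space)
    show "(LINT x|lebesgue_on (A k). \<bar>f x - g x\<bar>\<^sup>2 * w x) =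
       measure lebesgue (A k) * ((c k - h k)\<^sup>2 * d k) +
      (LINT x|lebesgue_on (A k). (h k - g x)\<^sup>2) * d k"
      using integral_square_diff_const(2)[OF gk[OF k], of "h k" "c k"] h[OF k]
      by (simp only: eqk[OF k] m) (simp add: algebra_simps)
  qed
  finally show ?thesis by (simp add: sum.distrib)
qed

section \<open>Square-integrable classes and their weighted error\<close>

lemma equiv_L2_rel: "equiv (L2_fun Q) (L2_rel Q)"
proof (rule equivI)
  show "L2_rel Q \<subseteq> L2_fun Q \<times> L2_fun Q" by (auto simp: L2_rel_def)
  show "refl_on (L2_fun Q) (L2_rel Q)" by (auto simp: refl_on_def L2_rel_def)
  show "sym (L2_rel Q)" by (auto simp: sym_def L2_rel_def elim: AE_mp)
  show "trans (L2_rel Q)"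
    unfolding trans_def L2_rel_def by (auto elim: AE_mp)
qed

lemma L2_class_in_L2: "f \<in> L2_fun Q \<Longrightarrow> L2_class Q f \<in> L2 Q"
  by (simp add: L2_class_def L2_def quotientI)

lemma L2_class_self: "f \<in> L2_fun Q \<Longrightarrow> f \<in> L2_class Q f"
  unfolding L2_class_def by (rule equiv_class_self[OF equiv_L2_rel])

text \<open>This allows a class to be represented by whichever member is convenient, in particular
  by one that is \<sigma>-monotonic off a null set.\<close>

lemma L2_memD:
  assumes "H \<in> L2 Q" "g \<in> H"
  shows "g \<in> L2_fun Q" "H = L2_class Q g"
proof -
  obtain h where H: "H = L2_rel Q `` {h}"
    using assms unfolding L2_def by (auto elim: quotientE)
  then have hg: "(h, g) \<in> L2_rel Q" using assms by auto
  then show "g \<in> L2_fun Q" by (auto simp: L2_rel_def)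
  show "H = L2_class Q g"
    unfolding H L2_class_def using equiv_class_eq[OF equiv_L2_rel hg] .
qed

lemma L2_class_eqI:
  assumes "f \<in> L2_fun Q" "g \<in> L2_fun Q" "AE x in lebesgue_on Q. f x = g x"
  shows "L2_class Q f = L2_class Q g"
  unfolding L2_class_def using assms
  by (intro equiv_class_eq[OF equiv_L2_rel]) (auto simp: L2_rel_def)

text \<open>Changing representatives alters the integrand only on a null set, so the image under
  \<open>the_elem\<close> has at most one element; \<open>f\<close> and \<open>h\<close> themselves
  show that it is nonempty.\<close>

lemma weighted_error_L2_class:
  assumes "f \<in> L2_fun Q" "h \<in> L2_fun Q" "w \<in> borel_measurable (lebesgue_on Q)"
  shows "weighted_error Q w (L2_class Q f) (L2_class Q h) =
    (LINT x|lebesgue_on Q. \<bar>f x - h x\<bar>\<^sup>2 * w x)"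
proof -
  have "(LINT x|lebesgue_on Q. \<bar>f' x - h' x\<bar>\<^sup>2 * w x) = (LINT x|lebesgue_on Q. \<bar>f x - h x\<bar>\<^sup>2 * w x)"
    if "f' \<in> L2_class Q f" "h' \<in> L2_class Q h" for f' h'
  proof (rule integral_cong_AE)
    have [measurable]: "f' \<in> borel_measurable (lebesgue_on Q)" "f \<in> borel_measurable (lebesgue_on Q)"
       "h' \<in> borel_measurable (lebesgue_on Q)" "h \<in> borel_measurable (lebesgue_on Q)"
      using that by (auto simp: L2_class_def L2_rel_def L2_fun_def)
    note [measurable] = assms(3)
    show "(\<lambda>x. \<bar>f' x - h' x\<bar>\<^sup>2 * w x) \<in> borel_measurable (lebesgue_on Q)"
      "(\<lambda>x. \<bar>f x - h x\<bar>\<^sup>2 * w x) \<in> borel_measurable (lebesgue_on Q)"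
      by measurable
    have "AE x in lebesgue_on Q. f x = f' x" "AE x in lebesgue_on Q. h x = h' x"
      using that by (auto simp: L2_class_def L2_rel_def)
    then show "AE x in lebesgue_on Q. \<bar>f' x - h' x\<bar>\<^sup>2 * w x = \<bar>f x - h x\<bar>\<^sup>2 * w x"
      by eventually_elim simp
  qed
  then have "(\<lambda>(f, h). LINT x|lebesgue_on Q. \<bar>f x - h x\<bar>\<^sup>2 * w x) ` (L2_class Q f \<times> L2_class Q h) =
      (\<lambda>_. LINT x|lebesgue_on Q. \<bar>f x - h x\<bar>\<^sup>2 * w x) ` (L2_class Q f \<times> L2_class Q h)"
    by (intro image_cong refl) (clarsimp simp only: mem_Times_iff fst_conv snd_conv split_paired_all prod.case)
  also have "\<dots> = {LINT x|lebesgue_on Q. \<bar>f x - h x\<bar>\<^sup>2 * w x}"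
    using L2_class_self[OF assms(1)] L2_class_self[OF assms(2)] by (intro image_constant[of "(f, h)"]) simp
  finally show ?thesis by (simp add: weighted_error_def)
qed

section \<open>Geometry of an equidistant grid\<close>

locale equidistant_grid =
  fixes a b :: "real ^ 'n" and m :: "'n \<Rightarrow> nat" and t :: "'n \<Rightarrow> nat \<Rightarrow> real"
  assumes less: "\<And>i. a $ i < b $ i"
    and partition: "grid_partition a b m t"
    and equidistant: "equidistant a b m t"
begin

text \<open>Multi-indices address grid points and cells alike, so sums over either become sums over
  one finite set.\<close>

definition "idx = {\<kappa>. \<forall>i. \<kappa> i \<in> {1..m i}}"
definition "lo \<kappa> = (\<chi> i. t i (\<kappa> i - 1))"
definition "hi \<kappa> = (\<chi> i. t i (\<kappa> i))"
definition "midpt \<kappa> = (\<chi> i. (t i (\<kappa> i - 1) + t i (\<kappa> i)) / 2)"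
definition "cell \<kappa> = {x :: real ^ 'n. \<forall>i. x $ i \<in> cell_interval m t i (\<kappa> i)}"
definition "width i = (b $ i - a $ i) / real (m i)"
definition "vol = (\<Prod>i\<in>UNIV. width i)"

text \<open>With \<open>m i = 0\<close> the two end conditions of the partition would force
  \<open>a $ i = b $ i\<close>.\<close>

lemma m_pos: "1 \<le> m i"
  using less[of i] partition unfolding grid_partition_def by (metis less_one linorder_not_less order_less_irrefl)

lemma width_pos: "0 < width i"
  using less[of i] m_pos[of i] by (simp add: width_def)

lemma vol_pos: "0 < vol"
  by (simp add: vol_def width_pos prod_pos)

lemma t_step: "k \<in> {1..m i} \<Longrightarrow> t i k = t i (k - 1) + width i"
  using equidistant by (auto simp: equidistant_def width_def algebra_simps)

lemma t_eq: "k \<le> m i \<Longrightarrow> t i k = a $ i + real k * width i"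
proof (induction k)
  case 0
  then show ?case using partition by (simp add: grid_partition_def)
next
  case (Suc k)
  then show ?case using t_step[of "Suc k" i] by (simp add: algebra_simps)
qed

lemma t_mono: "k \<le> k' \<Longrightarrow> k' \<le> m i \<Longrightarrow> t i k \<le> t i k'"
  using width_pos[of i] by (simp add: t_eq mult_right_mono)

lemma t_m: "t i (m i) = b $ i" and t_0: "t i 0 = a $ i"
  using partition by (auto simp: grid_partition_def)

lemma cell_interval_bounds:
  assumes "k \<in> {1..m i}" "x \<in> cell_interval m t i k"
  shows "t i (k - 1) \<le> x" "x \<le> t i k" "k < m i \<Longrightarrow> x < t i k"
  using assms by (auto simp: cell_interval_def split: if_splits)

text \<open>If \<open>k'\<close> were smaller than \<open>k\<close>, its interval would not be the
  last one and hence be open on the right, giving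
  \<open>y < t i k' \<le> t i (k - 1) \<le> x\<close>.\<close>

lemma cell_interval_mono:
  assumes k: "k \<in> {1..m i}" "k' \<in> {1..m i}"
    and x: "x \<in> cell_interval m t i k" and y: "y \<in> cell_interval m t i k'" and "x \<le> y"
  shows "k \<le> k'"
proof (rule ccontr)
  assume "\<not> k \<le> k'"
  then have "k' \<le> k - 1" "k' < m i" using k by auto
  then have "t i k' \<le> t i (k - 1)" using t_mono[of k' "k - 1" i] k by auto
  then show False
    using cell_interval_bounds[OF k(1) x] cell_interval_bounds[OF k(2) y] \<open>k' < m i\<close> \<open>x \<le> y\<close> by auto
qed

lemma cell_interval_unique:
  "\<lbrakk>k \<in> {1..m i}; k' \<in> {1..m i}; x \<in> cell_interval m t i k; x \<in> cell_interval m t i k'\<rbrakk> \<Longrightarrow> k = k'"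
  using cell_interval_mono[of k i k' x x] cell_interval_mono[of k' i k x x] by auto

lemma ex_cell_interval:
  assumes "a $ i \<le> x" "x \<le> b $ i"
  shows "\<exists>k\<in>{1..m i}. x \<in> cell_interval m t i k"
proof (cases "t i (m i - 1) \<le> x")
  case True
  then show ?thesis using assms m_pos[of i] by (intro bexI[of _ "m i"]) (auto simp: cell_interval_def t_m)
next
  case False
  \<comment> \<open>The first partition point beyond \<open>x\<close>. The case assumption places it
    before the index \<open>m i\<close>, so the values of \<open>t i\<close> past \<open>m i\<close>
    do not matter and the interval is half-open.\<close>
  define k where "k = (LEAST k. x < t i k)"
  have k: "x < t i k" unfolding k_def by (rule LeastI[of _ "m i - 1"]) (use False in auto)
  have le: "k \<le> m i - 1" unfolding k_def by (rule Least_le) (use False in auto)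
  have "k \<noteq> 0" using k assms by (metis linorder_not_less t_0)
  then have "t i (k - 1) \<le> x" using not_less_Least[of "k - 1" "\<lambda>k. x < t i k"] by (auto simp: k_def)
  then show ?thesis using k le \<open>k \<noteq> 0\<close> by (intro bexI[of _ k]) (auto simp: cell_interval_def)
qed

lemma finite_idx: "finite idx"
proof -
  have "idx = Pi\<^sub>E UNIV (\<lambda>i. {1..m i})" by (auto simp: idx_def PiE_def)
  then show ?thesis by (simp add: finite_PiE)
qed

lemma grid_points_eq: "grid_points m t = midpt ` idx"
proof -
  have "x \<in> midpt ` idx" if "x \<in> grid_points m t" for x
  proof -
    have "\<forall>i. \<exists>k. k \<in> {1..m i} \<and> x $ i = (t i (k - 1) + t i k) / 2"
      using that by (simp add: grid_points_def Bex_def)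
    from choice[OF this] obtain \<kappa>
      where "\<forall>i. \<kappa> i \<in> {1..m i} \<and> x $ i = (t i (\<kappa> i - 1) + t i (\<kappa> i)) / 2" ..
    then have "x = midpt \<kappa>" "\<kappa> \<in> idx" by (simp_all add: midpt_def idx_def vec_eq_iff)
    then show ?thesis by (rule image_eqI)
  qed
  then show ?thesis by (auto simp: grid_points_def midpt_def idx_def)
qed

lemma grid_cells_eq: "grid_cells m t = cell ` idx"
  by (auto simp: grid_cells_def cell_def idx_def)

lemma midpt_in_cell: "\<kappa> \<in> idx \<Longrightarrow> midpt \<kappa> \<in> cell \<kappa>"
proof -
  assume \<kappa>: "\<kappa> \<in> idx"
  have "(t i (\<kappa> i - 1) + t i (\<kappa> i)) / 2 \<in> cell_interval m t i (\<kappa> i)" for i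
    using \<kappa> t_step[of "\<kappa> i" i] width_pos[of i] by (simp add: idx_def cell_interval_def)
  then show ?thesis by (simp add: cell_def midpt_def)
qed

lemma cell_unique: "\<lbrakk>\<kappa> \<in> idx; \<kappa>' \<in> idx; x \<in> cell \<kappa>; x \<in> cell \<kappa>'\<rbrakk> \<Longrightarrow> \<kappa> = \<kappa>'"
proof
  fix i
  assume "\<kappa> \<in> idx" "\<kappa>' \<in> idx" "x \<in> cell \<kappa>" "x \<in> cell \<kappa>'"
  then show "\<kappa> i = \<kappa>' i"
    using cell_interval_unique[of "\<kappa> i" i "\<kappa>' i" "x $ i"] by (simp add: cell_def idx_def)
qed

lemma disjoint_cells: "disjoint_family_on cell idx"
  using cell_unique by (auto simp: disjoint_family_on_def)

text \<open>Each midpoint lies in its own cell, and distinct cells are disjoint.\<close>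

lemma inj_on_midpt: "inj_on midpt idx"
  using cell_unique midpt_in_cell by (metis inj_onI)

lemma cell_of_midpt: "\<kappa> \<in> idx \<Longrightarrow> cell_of m t (midpt \<kappa>) = cell \<kappa>"
  unfolding cell_of_def grid_cells_eq
  by (rule the_equality) (auto simp: midpt_in_cell dest: cell_unique[OF _ _ midpt_in_cell])

lemma cell_subset_cbox: "\<kappa> \<in> idx \<Longrightarrow> cell \<kappa> \<subseteq> cbox (lo \<kappa>) (hi \<kappa>)"
  using cell_interval_bounds by (auto simp: cell_def idx_def lo_def hi_def mem_box_cart)

lemma box_subset_cell: "box (lo \<kappa>) (hi \<kappa>) \<subseteq> cell \<kappa>"
  by (auto simp: cell_def lo_def hi_def mem_box_cart cell_interval_def less_imp_le)

lemma cbox_cell_subset: "\<kappa> \<in> idx \<Longrightarrow> cbox (lo \<kappa>) (hi \<kappa>) \<subseteq> cbox a b"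
proof -
  assume \<kappa>: "\<kappa> \<in> idx"
  have bounds: "a $ i \<le> t i (\<kappa> i - 1)" "t i (\<kappa> i) \<le> b $ i" for i
  proof -
    have "\<kappa> i \<le> m i" using \<kappa> by (simp add: idx_def)
    then show "a $ i \<le> t i (\<kappa> i - 1)" "t i (\<kappa> i) \<le> b $ i"
      using t_mono[of 0 "\<kappa> i - 1" i] t_mono[of "\<kappa> i" "m i" i] by (auto simp: t_0 t_m)
  qed
  show ?thesis
  proof
    fix x assume "x \<in> cbox (lo \<kappa>) (hi \<kappa>)"
    then have "t i (\<kappa> i - 1) \<le> x $ i" "x $ i \<le> t i (\<kappa> i)" for i
      by (auto simp: mem_box_cart lo_def hi_def)
    then show "x \<in> cbox a b"
      using order_trans[OF bounds(1)] order_trans[OF _ bounds(2)] unfolding mem_box_cart by blast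
  qed
qed

lemma Union_cells: "(\<Union>\<kappa>\<in>idx. cell \<kappa>) = cbox a b"
proof
  show "(\<Union>\<kappa>\<in>idx. cell \<kappa>) \<subseteq> cbox a b"
    using cell_subset_cbox cbox_cell_subset by blast
  show "cbox a b \<subseteq> (\<Union>\<kappa>\<in>idx. cell \<kappa>)"
  proof
    fix x assume "x \<in> cbox a b"
    then have "\<forall>i. \<exists>k. k \<in> {1..m i} \<and> x $ i \<in> cell_interval m t i k"
      using ex_cell_interval by (auto simp: mem_box_cart Bex_def)
    from choice[OF this] show "x \<in> (\<Union>\<kappa>\<in>idx. cell \<kappa>)"
      by (auto simp: idx_def cell_def)
  qed
qed

text \<open>The midpoint coordinate depends monotonically on the cell index, hence on the point.
  This carries monotonicity from the grid to the step function.\<close>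

lemma midpt_mono:
  assumes "\<kappa> \<in> idx" "\<kappa>' \<in> idx" "x \<in> cell \<kappa>" "y \<in> cell \<kappa>'" "sigma_le \<sigma> x y"
  shows "sigma_le \<sigma> (midpt \<kappa>) (midpt \<kappa>')"
proof -
  \<comment> \<open>Kept general in both cells and points: negative signs use it with the roles
    exchanged, and sign zero uses both directions to obtain equality.\<close>
  have mono: "midpt \<kappa> $ i \<le> midpt \<kappa>' $ i"
    if "\<kappa> \<in> idx" "\<kappa>' \<in> idx" "x \<in> cell \<kappa>" "y \<in> cell \<kappa>'" "x $ i \<le> y $ i" for \<kappa> \<kappa>' x y i
  proof -
    have "\<kappa> i \<le> \<kappa>' i"
      using that by (intro cell_interval_mono[of _ i _ "x $ i" "y $ i"]) (auto simp: idx_def cell_def)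
    moreover have "\<kappa>' i \<le> m i" using that(2) by (simp add: idx_def)
    ultimately have "t i (\<kappa> i) \<le> t i (\<kappa>' i)" "t i (\<kappa> i - 1) \<le> t i (\<kappa>' i - 1)"
      by (auto intro!: t_mono)
    then show ?thesis by (simp add: midpt_def)
  qed
  show ?thesis
    using assms(5) mono[OF assms(1-4)] mono[OF assms(2,1,4,3)]
    unfolding sigma_le_def by (auto intro: antisym)
qed

text \<open>Since the cell contains the open box, whatever it misses of the closed box lies in the
  frontier.\<close>

lemma negligible_cbox_diff_cell: "negligible (cbox (lo \<kappa>) (hi \<kappa>) - cell \<kappa>)"
  using negligible_frontier_interval[of "lo \<kappa>" "hi \<kappa>"] box_subset_cell[of \<kappa>]
  by (elim negligible_subset) auto

text \<open>Missing faces have measure zero, and by equidistance the side lengths do not depend on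
  the multi-index; hence \<open>vol\<close> carries no index.\<close>

lemma lmeasurable_cell: "\<kappa> \<in> idx \<Longrightarrow> cell \<kappa> \<in> lmeasurable"
  and measure_cell: "\<kappa> \<in> idx \<Longrightarrow> measure lebesgue (cell \<kappa>) = vol"
proof -
  assume \<kappa>: "\<kappa> \<in> idx"
  let ?B = "cbox (lo \<kappa>) (hi \<kappa>)"
  have neg: "negligible ((?B - cell \<kappa>) \<union> (cell \<kappa> - ?B))"
    using negligible_cbox_diff_cell[of \<kappa>] cell_subset_cbox[OF \<kappa>] by (simp add: Diff_eq_empty_iff[THEN iffD2])
  show "cell \<kappa> \<in> lmeasurable"
    by (rule lmeasurable_negligible_symdiff[OF _ neg]) auto
  have "measure lebesgue (cell \<kappa>) = measure lebesgue ?B"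
    by (rule measure_negligible_symdiff[OF _ neg]) auto
  also have "\<dots> = (\<Prod>i\<in>UNIV. hi \<kappa> $ i - lo \<kappa> $ i)"
  proof -
    have "lo \<kappa> $ i \<le> hi \<kappa> $ i" for i
      using \<kappa> width_pos[of i] t_step[of "\<kappa> i" i] by (auto simp: lo_def hi_def idx_def)
    then have "?B \<noteq> {}" by (simp add: interval_ne_empty_cart)
    then show ?thesis by (simp add: content_cbox_cart)
  qed
  also have "\<dots> = vol"
    using \<kappa> t_step unfolding vol_def by (intro prod.cong) (auto simp: lo_def hi_def idx_def)
  finally show "measure lebesgue (cell \<kappa>) = vol" .
qed

section \<open>Cell averages of monotonic functions\<close>

text \<open>Cells at the upper boundary contain faces that other cells omit, so cells need not be
  exact translates of each other. Passing to closed boxes removes this difference.\<close>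

lemma integral_cell_eq:
  assumes "\<kappa> \<in> idx" "integrable (lebesgue_on (cbox a b)) g"
  shows "g integrable_on cbox (lo \<kappa>) (hi \<kappa>)"
    and "(LINT x|lebesgue_on (cell \<kappa>). g x) = integral (cbox (lo \<kappa>) (hi \<kappa>)) (g :: _ \<Rightarrow> real)"
proof -
  have sets: "cell \<kappa> \<in> sets lebesgue" if "\<kappa> \<in> idx" for \<kappa> 
    using lmeasurable_cell[OF that] by auto
  have i: "integrable (lebesgue_on (cell \<kappa>)) g"
    using integrable_lebesgue_on_partition(1)[OF finite_idx disjoint_cells sets _ assms(1), of g] assms(2)
    by (simp add: Union_cells)
  have "g integrable_on cbox a b"
    using assms(2) by (simp add: integrable_on_lebesgue_on)
  then show "g integrable_on cbox (lo \<kappa>) (hi \<kappa>)"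
    using cbox_cell_subset[OF assms(1)] integrable_on_subcbox by blast
  have "(LINT x|lebesgue_on (cell \<kappa>). g x) = integral (cell \<kappa>) g"
    using i sets[OF assms(1)] by (rule lebesgue_integral_eq_integral)
  also have "\<dots> = integral (cbox (lo \<kappa>) (hi \<kappa>)) g"
    using cell_subset_cbox[OF assms(1)] negligible_cbox_diff_cell by (rule integral_subset_negligible)
  finally show "(LINT x|lebesgue_on (cell \<kappa>). g x) = integral (cbox (lo \<kappa>) (hi \<kappa>)) g" .
qed

text \<open>Translation by the difference of the midpoints carries one closed box onto the other and
  moves every point upwards in the \<sigma>-order. Hence \<open>g\<close> does not decrease along
  it, outside a null set.\<close>

lemma integral_cell_mono:
  assumes \<kappa>: "\<kappa> \<in> idx" "\<kappa>' \<in> idx" and le: "sigma_le \<sigma> (midpt \<kappa>) (midpt \<kappa>')"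
    and g: "integrable (lebesgue_on (cbox a b)) g"
    and N: "N \<in> null_sets lebesgue" and mono: "sigma_monotonic \<sigma> (cbox a b - N) g"
  shows "(LINT x|lebesgue_on (cell \<kappa>). g x) \<le> (LINT x|lebesgue_on (cell \<kappa>'). g x)"
proof -
  define v where "v = midpt \<kappa>' - midpt \<kappa>"
  \<comment> \<open>By equidistance, corners and midpoint of the two cells differ by the same
    half-widths.\<close>
  have v: "lo \<kappa>' = lo \<kappa> + v" "hi \<kappa>' = hi \<kappa> + v"
    using \<kappa> t_step by (auto simp: v_def lo_def hi_def midpt_def idx_def vec_eq_iff field_simps)
  \<comment> \<open>The \<sigma>-order is invariant under translation: only the difference of the
    two points matters.\<close>
  have "sigma_le \<sigma> x (x + v)" for x
    using le by (auto simp: sigma_le_def v_def algebra_simps)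
  moreover have "x + v \<in> cbox a b" if "x \<in> cbox (lo \<kappa>) (hi \<kappa>)" for x
  proof -
    have "x + v \<in> cbox (lo \<kappa>') (hi \<kappa>')" using that v by (simp add: mem_box_cart)
    then show ?thesis using cbox_cell_subset[OF \<kappa>(2)] by blast
  qed
  ultimately have "g x \<le> g (x + v)" if "x \<in> cbox (lo \<kappa>) (hi \<kappa>)" "x \<notin> N" "x + v \<notin> N" for x
    using that mono cbox_cell_subset[OF \<kappa>(1)] unfolding sigma_monotonic_def by blast
  then have "integral (cbox (lo \<kappa>) (hi \<kappa>)) g \<le> integral (cbox (lo \<kappa> + v) (hi \<kappa> + v)) g"
    using integral_cell_eq(1)[OF \<kappa>(1) g] integral_cell_eq(1)[OF \<kappa>(2) g] N
    unfolding v by (intro integral_cbox_translate_le[of g _ _ v N]) (auto simp: negligible_iff_null_sets)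
  then show ?thesis
    using integral_cell_eq(2)[OF \<kappa>(1) g] integral_cell_eq(2)[OF \<kappa>(2) g] v by simp
qed

section \<open>Grid-constant functions\<close>

lemma grid_constant_midpt: "\<lbrakk>grid_constant m t u; \<kappa> \<in> idx; x \<in> cell \<kappa>\<rbrakk> \<Longrightarrow> u x = u (midpt \<kappa>)"
  using midpt_in_cell by (auto simp: grid_constant_def grid_cells_eq constant_on_def)

lemma sum_indicator_cells:
  assumes "\<kappa> \<in> idx" "y \<in> cell \<kappa>"
  shows "(\<Sum>x\<in>grid_points m t. u x * indicator (cell_of m t x) y) = (u (midpt \<kappa>) :: real)"
proof -
  have "(\<Sum>x\<in>grid_points m t. u x * indicator (cell_of m t x) y) =
      (\<Sum>\<kappa>'\<in>idx. u (midpt \<kappa>') * indicator (cell \<kappa>') y)"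
    unfolding grid_points_eq sum.reindex[OF inj_on_midpt] o_def
    by (intro sum.cong) (auto simp: cell_of_midpt)
  also have "\<dots> = (\<Sum>\<kappa>'\<in>idx. if \<kappa>' = \<kappa> then u (midpt \<kappa>) else 0)"
    using assms cell_unique by (intro sum.cong) (auto simp: indicator_def)
  finally show ?thesis using assms finite_idx by (simp)
qed

lemma grid_constant_sum:
  "grid_constant m t (\<lambda>y. \<Sum>x\<in>grid_points m t. u x * indicator (cell_of m t x) y :: real)"
  unfolding grid_constant_def grid_cells_eq constant_on_def using sum_indicator_cells by auto

text \<open>On the box, \<open>u\<close> is a finite combination of indicators of measurable cells,
  hence measurable and bounded; its values elsewhere are arbitrary.\<close>

lemma grid_constant_L2_fun:
  assumes u: "grid_constant m t u"
  shows "u \<in> L2_fun (cbox a b)"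
proof -
  let ?s = "\<lambda>y. \<Sum>\<kappa>\<in>idx. u (midpt \<kappa>) * indicator (cell \<kappa>) y :: real"
  have eq: "u y = ?s y" if y: "y \<in> cbox a b" for y
  proof -
    obtain \<kappa> where \<kappa>: "\<kappa> \<in> idx" "y \<in> cell \<kappa>" using y Union_cells by blast
    have "?s y = (\<Sum>\<kappa>'\<in>idx. if \<kappa>' = \<kappa> then u (midpt \<kappa>) else 0)"
      using \<kappa> cell_unique by (intro sum.cong) (auto simp: indicator_def)
    then show ?thesis using \<kappa> finite_idx grid_constant_midpt[OF u \<kappa>] by simp
  qed
  have "?s \<in> borel_measurable lebesgue"
    using lmeasurable_cell by (intro borel_measurable_sum borel_measurable_times borel_measurable_indicator) auto
  then have s: "?s \<in> borel_measurable (lebesgue_on (cbox a b))"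
    by (rule measurable_restrict_space1)
  then have meas: "u \<in> borel_measurable (lebesgue_on (cbox a b))"
    by (subst measurable_cong[of _ _ ?s]) (auto simp: eq)
  define C where "C = (\<Sum>\<kappa>\<in>idx. \<bar>u (midpt \<kappa>)\<bar>)"
  have "norm ((u y)\<^sup>2) \<le> C\<^sup>2" if y: "y \<in> cbox a b" for y
  proof -
    obtain \<kappa> where \<kappa>: "\<kappa> \<in> idx" "y \<in> cell \<kappa>" using y Union_cells by blast
    have "\<bar>u y\<bar> \<le> C" unfolding C_def grid_constant_midpt[OF u \<kappa>]
      using \<kappa> finite_idx by (intro member_le_sum) auto
    then show ?thesis by (simp add: abs_le_square_iff[symmetric])
  qed
  then have "integrable (lebesgue_on (cbox a b)) (\<lambda>y. (u y)\<^sup>2)"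
    using meas finite_measure_lebesgue_on[of "cbox a b"]
    by (intro finite_measure.integrable_const_bound[of _ _ "C\<^sup>2"]) (auto intro!: AE_I2)
  then show ?thesis using meas by (simp add: L2_fun_def)
qed

section \<open>Comparison of errors in the projection problem\<close>

lemma proj_L2_grid_constant:
  fixes \<sigma> :: "int ^ 'n" and f w :: "real ^ 'n \<Rightarrow> real"
  assumes f: "grid_constant m t f" and w: "grid_constant m t w"
    and w_pos: "\<And>x. x \<in> cbox a b \<Longrightarrow> 0 < w x"
  defines "Q \<equiv> cbox a b" and "G \<equiv> grid_points m t"
  defines "p \<equiv> proj_finite \<sigma> G (restrict w G) (restrict f G)"
  defines "r \<equiv> (\<lambda>y. \<Sum>x\<in>G. p x * indicator (cell_of m t x) y)"
  shows "sigma_monotonic \<sigma> Q r"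
    and "proj_L2 \<sigma> Q w (L2_class Q f) = L2_class Q r"
proof -
  have Q: "(\<Union>\<kappa>\<in>idx. cell \<kappa>) = Q" by (simp add: Q_def Union_cells)
  have mid_G: "midpt \<kappa> \<in> G" if "\<kappa> \<in> idx" for \<kappa>
    using that by (simp add: G_def grid_points_eq)
  have w_mid: "0 < w (midpt \<kappa>)" if "\<kappa> \<in> idx" for \<kappa>
    using midpt_in_cell[OF that] that Q w_pos by (auto simp: Q_def)
  have r_cell: "r y = p (midpt \<kappa>)" if "\<kappa> \<in> idx" "y \<in> cell \<kappa>" for \<kappa> y
    using sum_indicator_cells[OF that, of p] by (simp add: r_def G_def)
  define fin_err where
    "fin_err g = (\<Sum>x\<in>G. \<bar>restrict f G x - g x\<bar>\<^sup>2 * restrict w G x)" for g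
  have fin_err_eq: "fin_err g = (\<Sum>\<kappa>\<in>idx. (f (midpt \<kappa>) - g (midpt \<kappa>))\<^sup>2 * w (midpt \<kappa>))" for g
    unfolding fin_err_def G_def grid_points_eq sum.reindex[OF inj_on_midpt]
    by (intro sum.cong) auto
  have w_G: "0 < restrict w G x" if "x \<in> G" for x
    using w_mid that by (auto simp: G_def grid_points_eq)
  have fin_G: "finite G" using finite_idx by (simp add: G_def grid_points_eq)
  note p_min = proj_finite_is_arg_min[where \<sigma> = \<sigma> and f = "restrict f G" and w = "restrict w G",
      OF fin_G w_G, folded fin_err_def p_def, unfolded is_arg_min_linorder]
  have p_mono: "sigma_monotonic \<sigma> G p"
    and p_le: "\<And>g. g \<in> G \<rightarrow>\<^sub>E UNIV \<Longrightarrow> sigma_monotonic \<sigma> G g \<Longrightarrow> fin_err p \<le> fin_err g"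
    using p_min(1) by auto
  \<comment> \<open>A competitor whose error does not exceed that of \<open>p\<close> is itself a
    minimizer, so uniqueness applies to it.\<close>
  have p_unique: "g = p" if "g \<in> G \<rightarrow>\<^sub>E UNIV" "sigma_monotonic \<sigma> G g" "fin_err g \<le> fin_err p" for g
    using p_min(2)[of g] p_le that by (meson order_trans)
  show r_mono: "sigma_monotonic \<sigma> Q r"
    unfolding sigma_monotonic_def
  proof (intro ballI impI)
    fix x y assume xy: "x \<in> Q" "y \<in> Q" "sigma_le \<sigma> x y"
    then obtain \<kappa> \<kappa>' where \<kappa>: "\<kappa> \<in> idx" "\<kappa>' \<in> idx" "x \<in> cell \<kappa>" "y \<in> cell \<kappa>'"
      using Q by blast
    have "p (midpt \<kappa>) \<le> p (midpt \<kappa>')"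
      using p_mono midpt_mono[OF \<kappa> xy(3)] mid_G \<kappa>(1,2) unfolding sigma_monotonic_def by blast
    then show "r x \<le> r y" using \<kappa> by (simp add: r_cell)
  qed
  have f_L2: "f \<in> L2_fun Q" and w_meas: "w \<in> borel_measurable (lebesgue_on Q)"
    using grid_constant_L2_fun[OF f] grid_constant_L2_fun[OF w] by (auto simp: Q_def L2_fun_def)
  have r_L2: "r \<in> L2_fun Q"
    unfolding r_def G_def Q_def by (intro grid_constant_L2_fun grid_constant_sum)
  have R_sigma: "L2_class Q r \<in> L2_sigma \<sigma> Q"
    using r_mono L2_class_in_L2[OF r_L2] L2_class_self[OF r_L2]
    by (auto simp: L2_sigma_def intro!: bexI[of _ r] bexI[of _ "{}"])
  have sets: "cell \<kappa> \<in> sets lebesgue" if "\<kappa> \<in> idx" for \<kappa>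
    using lmeasurable_cell[OF that] by auto
  \<comment> \<open>Here \<open>h\<close> holds the cell averages of \<open>g\<close> at the
    midpoints. The common cell volume factors out of the first sum and leaves the finite
    error.\<close>
  have error: "weighted_error Q w (L2_class Q f) (L2_class Q g) = vol * fin_err h +
        (\<Sum>\<kappa>\<in>idx. (LINT x|lebesgue_on (cell \<kappa>). (h (midpt \<kappa>) - g x)\<^sup>2) * w (midpt \<kappa>))"
    if "g \<in> L2_fun Q" "\<And>\<kappa>. \<kappa> \<in> idx \<Longrightarrow> vol * h (midpt \<kappa>) = (LINT x|lebesgue_on (cell \<kappa>). g x)" for g h
    using L2_error_partition[OF finite_idx disjoint_cells lmeasurable_cell, of g f "\<lambda>\<kappa>. f (midpt \<kappa>)" w
        "\<lambda>\<kappa>. w (midpt \<kappa>)" "\<lambda>\<kappa>. h (midpt \<kappa>)"] that grid_constant_midpt[OF f] grid_constant_midpt[OF w]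
    by (simp add: weighted_error_L2_class[OF f_L2 that(1) w_meas] Q measure_cell fin_err_eq sum_distrib_left)
  \<comment> \<open>The general \<open>F\<close> serves twice: the identity gives the averages of
    \<open>r\<close>, a squared deviation gives its variances.\<close>
  have r_int: "(LINT x|lebesgue_on (cell \<kappa>). F (r x)) = vol * F (p (midpt \<kappa>))" if "\<kappa> \<in> idx" for F :: "real \<Rightarrow> real" and \<kappa>
  proof -
    have "(LINT x|lebesgue_on (cell \<kappa>). F (r x)) = (LINT x|lebesgue_on (cell \<kappa>). F (p (midpt \<kappa>)))"
      using that by (intro Bochner_Integration.integral_cong) (auto simp: r_cell)
    also have "\<dots> = vol * F (p (midpt \<kappa>))"
      using sets[OF that] by (simp add: measure_restrict_space space_restrict_space measure_cell[OF that])
    finally show ?thesis .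
  qed
  have error_r: "weighted_error Q w (L2_class Q f) (L2_class Q r) = vol * fin_err p"
  proof -
    have "(LINT x|lebesgue_on (cell \<kappa>). (p (midpt \<kappa>) - r x)\<^sup>2) = 0" if "\<kappa> \<in> idx" for \<kappa>
      using r_int[OF that, of "\<lambda>z. (p (midpt \<kappa>) - z)\<^sup>2"] by simp
    then show ?thesis
      using error[OF r_L2, of p] r_int[of _ "\<lambda>z. z"] by simp
  qed
  \<comment> \<open>The first conjunct makes \<open>r\<close> a minimizer; the second makes it the
    only one, as the definite description in \<open>proj_L2\<close> requires.\<close>
  have H: "weighted_error Q w (L2_class Q f) (L2_class Q r) \<le> weighted_error Q w (L2_class Q f) H \<and>
      (weighted_error Q w (L2_class Q f) H \<le> weighted_error Q w (L2_class Q f) (L2_class Q r) \<longrightarrow>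
        H = L2_class Q r)"
    if "H \<in> L2_sigma \<sigma> Q" for H
  proof -
    obtain g N where gH: "g \<in> H" "H \<in> L2 Q" and N: "N \<in> null_sets lebesgue" "sigma_monotonic \<sigma> (Q - N) g"
      using \<open>H \<in> L2_sigma \<sigma> Q\<close> by (auto simp: L2_sigma_def)
    note g = L2_memD[OF gH(2,1)]
    have g_int: "integrable (lebesgue_on Q) g"
    proof (rule integrable_square_imp_integrable)
      show "finite_measure (lebesgue_on Q)"
        unfolding Q_def by (rule finite_measure_lebesgue_on) simp
    qed (use g(1) in \<open>auto simp: L2_fun_def\<close>)
    define avg where "avg \<kappa> = (LINT x|lebesgue_on (cell \<kappa>). g x) / vol" for \<kappa>
    \<comment> \<open>The averages are transported to the grid points through the inverse of
      \<open>midpt\<close>, and \<open>restrict\<close> makes the result a competitor in the finite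
      problem.\<close>
    define h where "h = restrict (\<lambda>x. avg (the_inv_into idx midpt x)) G"
    have h_mid: "h (midpt \<kappa>) = avg \<kappa>" if "\<kappa> \<in> idx" for \<kappa>
      using that mid_G by (simp add: h_def the_inv_into_f_f[OF inj_on_midpt])
    have h_G: "h \<in> G \<rightarrow>\<^sub>E UNIV" by (simp add: h_def)
    have h_mono: "sigma_monotonic \<sigma> G h"
      unfolding sigma_monotonic_def
    proof (intro ballI impI)
      fix x y assume "x \<in> G" "y \<in> G" and le: "sigma_le \<sigma> x y"
      then obtain \<kappa> \<kappa>' where \<kappa>: "\<kappa> \<in> idx" "\<kappa>' \<in> idx" "x = midpt \<kappa>" "y = midpt \<kappa>'"
        by (auto simp: G_def grid_points_eq)
      have "avg \<kappa> \<le> avg \<kappa>'"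
        unfolding avg_def using vol_pos integral_cell_mono[OF \<kappa>(1,2), of \<sigma> g N] le g_int N \<kappa>(3,4)
        by (intro divide_right_mono) (auto simp: Q_def)
      then show "h x \<le> h y" using \<kappa> by (simp add: h_mid)
    qed
    let ?V = "\<lambda>\<kappa>. LINT x|lebesgue_on (cell \<kappa>). (h (midpt \<kappa>) - g x)\<^sup>2"
    have err: "weighted_error Q w (L2_class Q f) H = vol * fin_err h + (\<Sum>\<kappa>\<in>idx. ?V \<kappa> * w (midpt \<kappa>))"
      unfolding g(2) using vol_pos by (intro error[OF g(1)]) (simp add: h_mid avg_def)
    have V_nonneg: "0 \<le> ?V \<kappa> * w (midpt \<kappa>)" if "\<kappa> \<in> idx" for \<kappa>
      using w_mid[OF that] by (intro mult_nonneg_nonneg) auto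
    then have sum_nonneg: "0 \<le> (\<Sum>\<kappa>\<in>idx. ?V \<kappa> * w (midpt \<kappa>))" by (rule sum_nonneg)
    have fin_le: "vol * fin_err p \<le> vol * fin_err h"
      using p_le[OF h_G h_mono] vol_pos by simp
    have "H = L2_class Q r"
      if "weighted_error Q w (L2_class Q f) H \<le> weighted_error Q w (L2_class Q f) (L2_class Q r)"
    proof -
      \<comment> \<open>The finite error is at least that of \<open>p\<close> and the variance term
        is nonnegative, so a total no larger than that of \<open>r\<close> leaves no slack in
        either.\<close>
      have "vol * fin_err h \<le> vol * fin_err p" and sum_le: "(\<Sum>\<kappa>\<in>idx. ?V \<kappa> * w (midpt \<kappa>)) \<le> 0"
        using that fin_le sum_nonneg unfolding err error_r by linarith+
      then have "h = p" using vol_pos by (intro p_unique h_G h_mono) simp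
      have "(\<Sum>\<kappa>\<in>idx. ?V \<kappa> * w (midpt \<kappa>)) = 0" using sum_le sum_nonneg by (rule antisym)
      then have V0: "?V \<kappa> = 0" if "\<kappa> \<in> idx" for \<kappa>
        using sum_nonneg_eq_0_iff[OF finite_idx V_nonneg] w_mid[OF that] that by fastforce
      have AE_cell: "AE x in lebesgue. x \<in> cell \<kappa> \<longrightarrow> g x = r x" if \<kappa>: "\<kappa> \<in> idx" for \<kappa>
      proof -
        have int: "integrable (lebesgue_on (cell \<kappa>)) (\<lambda>x. (h (midpt \<kappa>) - g x)\<^sup>2)"
        proof (rule integral_square_diff_const(1))
          show "finite_measure (lebesgue_on (cell \<kappa>))"
            using lmeasurable_cell[OF \<kappa>] by (rule finite_measure_lebesgue_on)
          show "g \<in> borel_measurable (lebesgue_on (cell \<kappa>))"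
            using g(1) \<kappa> Q by (auto simp: L2_fun_def intro: measurable_restrict_mono)
          show "integrable (lebesgue_on (cell \<kappa>)) (\<lambda>x. (g x)\<^sup>2)"
            using g(1) integrable_lebesgue_on_partition(1)[OF finite_idx disjoint_cells sets _ \<kappa>]
            by (simp add: L2_fun_def Q)
        qed
        \<comment> \<open>Vanishing variance means that \<open>g\<close> equals its average almost
          everywhere on the cell.\<close>
        have "AE x in lebesgue_on (cell \<kappa>). h (midpt \<kappa>) = g x"
          using V0[OF \<kappa>] integral_nonneg_eq_0_iff_AE[OF int] by simp
        then have "AE x in lebesgue. x \<in> cell \<kappa> \<longrightarrow> h (midpt \<kappa>) = g x"
          using sets[OF \<kappa>] by (simp add: AE_restrict_space_iff)
        then show ?thesis
          by eventually_elim (simp add: r_cell[OF \<kappa>] \<open>h = p\<close>)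
      qed
      \<comment> \<open>As there are finitely many cells, the exceptional null sets can be
        combined.\<close>
      have "AE x in lebesgue. \<forall>\<kappa>\<in>idx. x \<in> cell \<kappa> \<longrightarrow> g x = r x"
        using AE_cell by (intro AE_finite_allI finite_idx)
      then have "AE x in lebesgue. x \<in> Q \<longrightarrow> g x = r x"
        by eventually_elim (use Q in blast)
      then have "AE x in lebesgue_on Q. g x = r x"
        by (subst AE_restrict_space_iff) (auto simp: Q_def)
      then show ?thesis unfolding g(2) by (intro L2_class_eqI g(1) r_L2)
    qed
    then show ?thesis using fin_le sum_nonneg unfolding err error_r by simp
  qed
  show "proj_L2 \<sigma> Q w (L2_class Q f) = L2_class Q r"
    unfolding proj_L2_def
  proof (rule the_equality)
    show "is_arg_min (weighted_error Q w (L2_class Q f)) (\<lambda>H. H \<in> L2_sigma \<sigma> Q) (L2_class Q r)"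
      using R_sigma H by (simp add: is_arg_min_linorder)
    show "H' = L2_class Q r"
      if "is_arg_min (weighted_error Q w (L2_class Q f)) (\<lambda>H. H \<in> L2_sigma \<sigma> Q) H'" for H'
      using that R_sigma H[of H'] by (simp add: is_arg_min_linorder)
  qed
qed

end

section \<open>The projection as a step function on the grid\<close>

theorem theorem3p2:
  fixes a b :: "real ^ 'n" and \<sigma> :: "int ^ 'n"
    and m :: "'n \<Rightarrow> nat" and t :: "'n \<Rightarrow> nat \<Rightarrow> real"
    and f w :: "real ^ 'n \<Rightarrow> real"
  assumes "\<And>i. a $ i < b $ i"
    and "\<And>i. \<sigma> $ i \<in> {-1, 0, 1}"
    and "grid_partition a b m t"
    and "equidistant a b m t"
    and "grid_constant m t f"
    and "grid_constant m t w"
    and "\<And>x. x \<in> cbox a b \<Longrightarrow> 0 < w x"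
  defines "Q \<equiv> cbox a b"
    and "G \<equiv> grid_points m t"
  defines "P \<equiv> proj_L2 \<sigma> Q w (L2_class Q f)"
    and "r \<equiv> (\<lambda>y. \<Sum>x\<in>G. proj_finite \<sigma> G (restrict w G) (restrict f G) x
                       * indicator (cell_of m t x) y)"
  shows "grid_constant_class m t P \<and> P = L2_class Q r \<and> r \<in> P \<and> sigma_monotonic \<sigma> Q r"
proof -
  interpret equidistant_grid a b m t
    using assms(1,3,4) by unfold_locales
  have P: "P = L2_class Q r" and mono: "sigma_monotonic \<sigma> Q r"
    using proj_L2_grid_constant[OF assms(5-7), of \<sigma>] unfolding P_def r_def Q_def G_def by auto
  have const: "grid_constant m t r"
    unfolding r_def G_def by (rule grid_constant_sum)
  then have "r \<in> P"
    unfolding P Q_def by (intro L2_class_self grid_constant_L2_fun)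
  then show ?thesis
    using P mono const unfolding grid_constant_class_def by blast
qed

end
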